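(* Let $m\ge 1$ and let $b\in P_m$ be any pure $m$-braid. Let $f(b)$ be its (unreduced) Burau matrix, $C(b)$ its crossing matrix, and $L_{C(b)}$ the Laplacian of $C(b)$. Then $$\left.\frac{d}{dt}f(b)\right|_{t=1}=L_{C(b)}.$$
   Context: $B_m$ is the braid group with Artin generators $\sigma_1,\dots,\sigma_{m-1}$ and relations $\sigma_i\sigma_{i+1}\sigma_i=\sigma_{i+1}\sigma_i\sigma_{i+1}$ ($1\le i\le m-2$), $\sigma_i\sigma_j=\sigma_j\sigma_i$ ($|i-j|>1$). A word in the $\sigma_i^{\pm1}$ is read from left to right as a braid diagram from top to bottom. The $i$th strand of a braid is the strand whose upper endpoint is in the $i$th position from the left. A pure braid is a braid whose induced permutation of $\{1,\dots,m\}$ (sending the upper position of each strand to its lower position) is the identity; $P_m\subset B_m$ is the subgroup of pure braids, i.e. the kernel of $B_m\to S_m$, $\sigma_i\mapsto (i\ i+1)$. Burau matrix: let $\Lambda=\mathbb{Z}[t,t^{-1}]$. The (unreduced) Burau representation is the group homomorphism $f:B_m\to GL_m(\Lambda)$ with $$f(\sigma_i)=I_{i-1}\oplus\begin{bmatrix}1-t&1\\ t&0\end{bmatrix}\oplus I_{m-i-1}\quad(1\le i\le m-1).$$ For $f(b)=[f_{ij}(b;t)]$, $\frac{d}{dt}f(b)=\left[\frac{d}{dt}f_{ij}(b;t)\right]$ (entrywise derivative), and $|_{t=1}$ denotes entrywise evaluation. Crossing matrix: for a diagram (word) $\beta$ of $b\in B_m$, a crossing coming from a letter $\sigma_k$ is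 positive and one coming from $\sigma_k^{-1}$ is negative. At a letter $\sigma_k$ the strand moving from position $k+1$ to position $k$ passes over the strand moving from position $k$ to position $k+1$; at a letter $\sigma_k^{-1}$ the strand moving from position $k$ to position $k+1$ passes over the other. The crossing matrix $C(b)\in M_m(\mathbb{Z})$ has zero diagonal, and for $i\ne j$ its $(i,j)$ entry is the number of positive crossings minus the number of negative crossings of $\beta$ at which the $i$th strand is over the $j$th strand. It is known that this is independent of the diagram $\beta$ of $b$, and that $C(b)$ is symmetric when $b$ is pure. Laplacian: for a symmetric $m\times m$ matrix $A=[a_{ij}]$ with zero diagonal, the degree matrix $D_A$ is the diagonal matrix with $i$th diagonal entry $\sum_{j\ne i}a_{ij}$, and the Laplacian of $A$ is $L_A=D_A-A$. *)

theory Defs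
  imports
    "HOL-Library.Poly_Mapping"
    "HOL-Combinatorics.Transposition"
    "HOL-Algebra.Coset"
    "Jordan_Normal_Form.Matrix"
begin

section \<open>Laurent polynomials with integer coefficients\<close>

text \<open>
  Finitely supported functions from the integers to the integers, with the convolution
  product of \<^theory>\<open>HOL-Library.Poly_Mapping\<close>, form the ring of integral Laurent polynomials;
  the coefficient of the \<open>k\<close>-th power of the variable is \<open>Poly_Mapping.lookup p k\<close>.
\<close>

type_synonym laurent = "int \<Rightarrow>\<^sub>0 int"

definition tpow :: "int \<Rightarrow> laurent" where
  "tpow k = Poly_Mapping.single k 1"

lemma tpow_0: "tpow 0 = 1"
  by (simp add: tpow_def)

lemma tpow_add: "tpow (a + b) = tpow a * tpow b"
  by (simp add: tpow_def mult_single)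

definition laurent_deriv :: "laurent \<Rightarrow> laurent" where
  "laurent_deriv p =
     (\<Sum>k\<in>Poly_Mapping.keys p. Poly_Mapping.single (k - 1) (k * Poly_Mapping.lookup p k))"

definition laurent_eval :: "laurent \<Rightarrow> 'a::field \<Rightarrow> 'a" where
  "laurent_eval p x =
     (\<Sum>k\<in>Poly_Mapping.keys p. of_int (Poly_Mapping.lookup p k) * x powi k)"

lemma laurent_deriv_tpow: "laurent_deriv (tpow k) = Poly_Mapping.single (k - 1) k"
  by (simp add: laurent_deriv_def tpow_def)

lemma laurent_eval_tpow: "laurent_eval (tpow k) x = x powi k"
  by (simp add: laurent_eval_def tpow_def)


section \<open>Braid groups\<close>

text \<open>
  Words are read from left to right, diagrams from top to bottom.
  The letters \<open>Gen k\<close> and \<open>Gen_inv k\<close> stand for the \<open>k\<close>-th Artin generator and its inverse;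
  generators and positions are counted from \<open>1\<close>.
\<close>

datatype letter = Gen nat | Gen_inv nat

type_synonym braid_word = "letter list"

fun letter_index :: "letter \<Rightarrow> nat" where
  "letter_index (Gen k) = k"
| "letter_index (Gen_inv k) = k"

definition braid_words :: "nat \<Rightarrow> braid_word set" where
  "braid_words m = {w. \<forall>x\<in>set w. 1 \<le> letter_index x \<and> letter_index x < m}"

inductive braid_relator :: "nat \<Rightarrow> braid_word \<Rightarrow> braid_word \<Rightarrow> bool" for m where
  cancel: "1 \<le> i \<Longrightarrow> i < m \<Longrightarrow> braid_relator m [Gen i, Gen_inv i] []"
| cancel_inv: "1 \<le> i \<Longrightarrow> i < m \<Longrightarrow> braid_relator m [Gen_inv i, Gen i] []"
| braid: "1 \<le> i \<Longrightarrow> i + 1 < m \<Longrightarrow>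
    braid_relator m [Gen i, Gen (i + 1), Gen i] [Gen (i + 1), Gen i, Gen (i + 1)]"
| commute: "1 \<le> i \<Longrightarrow> i < m \<Longrightarrow> 1 \<le> j \<Longrightarrow> j < m \<Longrightarrow> \<bar>int i - int j\<bar> > 1 \<Longrightarrow>
    braid_relator m [Gen i, Gen j] [Gen j, Gen i]"

inductive braid_equiv :: "nat \<Rightarrow> braid_word \<Rightarrow> braid_word \<Rightarrow> bool" for m where
  rel: "u \<in> braid_words m \<Longrightarrow> v \<in> braid_words m \<Longrightarrow> braid_relator m x y \<Longrightarrow>
    braid_equiv m (u @ x @ v) (u @ y @ v)"
| refl: "w \<in> braid_words m \<Longrightarrow> braid_equiv m w w"
| sym: "braid_equiv m v w \<Longrightarrow> braid_equiv m w v"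
| trans: "braid_equiv m u v \<Longrightarrow> braid_equiv m v w \<Longrightarrow> braid_equiv m u w"

definition braid_rel :: "nat \<Rightarrow> (braid_word \<times> braid_word) set" where
  "braid_rel m = {(v, w). braid_equiv m v w}"

definition braid_class :: "nat \<Rightarrow> braid_word \<Rightarrow> braid_word set" where
  "braid_class m w = braid_rel m `` {w}"

definition braid_group :: "nat \<Rightarrow> braid_word set monoid" where
  "braid_group m =
     \<lparr>carrier = braid_words m // braid_rel m,
      monoid.mult = (\<lambda>a b. \<Union>v\<in>a. \<Union>w\<in>b. braid_class m (v @ w)),
      one = braid_class m []\<rparr>"

lemma braid_words_append [simp]:
  "v @ w \<in> braid_words m \<longleftrightarrow> v \<in> braid_words m \<and> w \<in> braid_words m"
  by (auto simp: braid_words_def)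

lemma braid_words_Nil [simp]: "[] \<in> braid_words m"
  by (simp add: braid_words_def)

lemma braid_words_Cons [simp]:
  "x # w \<in> braid_words m \<longleftrightarrow> 1 \<le> letter_index x \<and> letter_index x < m \<and> w \<in> braid_words m"
  by (auto simp: braid_words_def)

lemma braid_relator_words:
  "braid_relator m x y \<Longrightarrow> x \<in> braid_words m \<and> y \<in> braid_words m"
  by (induction rule: braid_relator.induct) auto

lemma braid_equiv_words:
  "braid_equiv m v w \<Longrightarrow> v \<in> braid_words m \<and> w \<in> braid_words m"
  by (induction rule: braid_equiv.induct) (auto dest: braid_relator_words)

lemma equiv_braid_rel: "equiv (braid_words m) (braid_rel m)"
  by (intro equivI refl_onI symI transI)
     (auto simp: braid_rel_def dest: braid_equiv_words intro: braid_equiv.intros)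

lemma braid_equiv_context:
  "braid_equiv m v w \<Longrightarrow> p \<in> braid_words m \<Longrightarrow> q \<in> braid_words m \<Longrightarrow>
    braid_equiv m (p @ v @ q) (p @ w @ q)"
proof (induction rule: braid_equiv.induct)
  case (rel u v x y)
  then show ?case
    using braid_equiv.rel[of "p @ u" m "v @ q" x y] by simp
qed (auto intro: braid_equiv.intros)

lemma braid_equiv_append:
  assumes "braid_equiv m v v'" "braid_equiv m w w'"
  shows "braid_equiv m (v @ w) (v' @ w')"
  using braid_equiv_context[OF assms(1), of "[]" w] braid_equiv_context[OF assms(2), of v' "[]"]
    braid_equiv_words[OF assms(1)] braid_equiv_words[OF assms(2)]
  by (auto intro: braid_equiv.trans)

lemma braid_class_eq_iff:
  "v \<in> braid_words m \<Longrightarrow> w \<in> braid_words m \<Longrightarrow>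
    braid_class m v = braid_class m w \<longleftrightarrow> braid_equiv m v w"
  unfolding braid_class_def
  using eq_equiv_class_iff[OF equiv_braid_rel] by (auto simp: braid_rel_def)

lemma mem_braid_class: "v \<in> braid_class m w \<longleftrightarrow> braid_equiv m w v"
  by (simp add: braid_class_def braid_rel_def)

lemma carrier_braid_group: "carrier (braid_group m) = braid_class m ` braid_words m"
  by (auto simp: braid_group_def braid_class_def quotient_def)

lemma one_braid_group: "\<one>\<^bsub>braid_group m\<^esub> = braid_class m []"
  by (simp add: braid_group_def)

lemma mult_braid_group:
  assumes "v \<in> braid_words m" "w \<in> braid_words m"
  shows "braid_class m v \<otimes>\<^bsub>braid_group m\<^esub> braid_class m w = braid_class m (v @ w)"
proof -
  have "braid_class m (v' @ w') = braid_class m (v @ w)"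
    if "v' \<in> braid_class m v" "w' \<in> braid_class m w" for v' w'
  proof -
    have "braid_equiv m v v'" "braid_equiv m w w'"
      using that by (simp_all add: mem_braid_class)
    then have "braid_equiv m (v @ w) (v' @ w')"
      by (rule braid_equiv_append)
    then show ?thesis
      using braid_equiv_words braid_class_eq_iff by (metis (no_types))
  qed
  moreover have "v \<in> braid_class m v" "w \<in> braid_class m w"
    using assms by (auto simp: mem_braid_class intro: braid_equiv.refl)
  ultimately have "(\<Union>x\<in>braid_class m v. \<Union>y\<in>braid_class m w. braid_class m (x @ y)) =
      braid_class m (v @ w)"
    by blast
  then show ?thesis
    by (simp add: braid_group_def)
qed

fun letter_inv :: "letter \<Rightarrow> letter" where
  "letter_inv (Gen k) = Gen_inv k"
| "letter_inv (Gen_inv k) = Gen k"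

lemma letter_inv_inv: "letter_inv (letter_inv x) = x"
  by (cases x) auto

lemma braid_word_inv:
  "w \<in> braid_words m \<Longrightarrow> rev (map letter_inv w) \<in> braid_words m \<and>
     braid_equiv m (rev (map letter_inv w) @ w) []"
proof (induction w)
  case Nil
  then show ?case by (auto intro: braid_equiv.refl)
next
  case (Cons x w)
  let ?v = "rev (map letter_inv w)"
  have "braid_relator m [letter_inv x, x] []"
    using Cons.prems by (cases x) (auto intro: braid_relator.intros)
  then have "braid_equiv m (?v @ [letter_inv x, x] @ w) (?v @ [] @ w)"
    using Cons by (intro braid_equiv.rel) auto
  moreover have "letter_index (letter_inv x) = letter_index x"
    by (cases x) auto
  ultimately show ?case
    using Cons by (auto intro: braid_equiv.trans)
qed

lemma group_braid_group: "group (braid_group m)"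
proof (rule groupI)
  fix x assume "x \<in> carrier (braid_group m)"
  then obtain w where "w \<in> braid_words m" "x = braid_class m w"
    by (auto simp: carrier_braid_group)
  moreover note braid_word_inv[of w m]
  ultimately show "\<exists>y\<in>carrier (braid_group m). y \<otimes>\<^bsub>braid_group m\<^esub> x = \<one>\<^bsub>braid_group m\<^esub>"
    by (auto simp: carrier_braid_group one_braid_group mult_braid_group braid_class_eq_iff
             intro!: bexI[of _ "rev (map letter_inv w)"])
qed (auto simp: carrier_braid_group one_braid_group mult_braid_group)

text \<open>
  Functions on words that respect the braid relations are lifted to the braid group by taking
  their common value on all words in a class.
\<close>

lemma the_elem_braid_class:
  assumes "w \<in> braid_words m" and "\<And>v w. braid_equiv m v w \<Longrightarrow> g v = g w"
  shows "the_elem (g ` braid_class m w) = g w"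
proof -
  have "w \<in> braid_class m w"
    using assms(1) by (simp add: mem_braid_class braid_equiv.refl)
  moreover have "g v = g w" if "v \<in> braid_class m w" for v
    using that assms(2)[of w v] by (simp add: mem_braid_class)
  ultimately have "g ` braid_class m w = {g w}"
    by blast
  then show ?thesis by simp
qed


section \<open>Induced permutations and pure braids\<close>

text \<open>\<open>lower_position w p\<close> follows the strand starting in position \<open>p\<close> down to its lower end.\<close>

fun lower_position :: "braid_word \<Rightarrow> nat \<Rightarrow> nat" where
  "lower_position [] p = p"
| "lower_position (x # w) p =
     lower_position w (transpose (letter_index x) (letter_index x + 1) p)"

definition braid_perm :: "braid_word set \<Rightarrow> nat \<Rightarrow> nat" where
  "braid_perm b = the_elem (lower_position ` b)"

text \<open>Positions outside \<open>{1..m}\<close> are fixed by every braid on \<open>m\<close> strands.\<close>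

definition pure_braids :: "nat \<Rightarrow> braid_word set set" where
  "pure_braids m = {b \<in> carrier (braid_group m). \<forall>p\<in>{1..m}. braid_perm b p = p}"

lemma lower_position_append:
  "lower_position (v @ w) p = lower_position w (lower_position v p)"
  by (induction v arbitrary: p) auto

lemma lower_position_relator:
  "braid_relator m x y \<Longrightarrow> lower_position x p = lower_position y p"
  by (induction rule: braid_relator.induct) (auto simp: transpose_def)

lemma lower_position_equiv: "braid_equiv m v w \<Longrightarrow> lower_position v = lower_position w"
  by (induction rule: braid_equiv.induct)
     (auto simp: fun_eq_iff lower_position_append lower_position_relator)

lemma braid_perm_class:
  "w \<in> braid_words m \<Longrightarrow> braid_perm (braid_class m w) = lower_position w"
  unfolding braid_perm_def by (rule the_elem_braid_class) (auto intro: lower_position_equiv)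


section \<open>The Burau representation\<close>

definition burau_gen :: "nat \<Rightarrow> nat \<Rightarrow> laurent mat" where
  "burau_gen m i =
     diag_block_mat [1\<^sub>m (i - 1),
                     mat_of_rows_list 2 [[1 - tpow 1, 1], [tpow 1, 0]],
                     1\<^sub>m (m - i - 1)]"

text \<open>The inverse of \<open>burau_gen m i\<close>, see the case \<open>cancel\<close> of \<open>burau_relator\<close> below.\<close>

definition burau_gen_inv :: "nat \<Rightarrow> nat \<Rightarrow> laurent mat" where
  "burau_gen_inv m i =
     diag_block_mat [1\<^sub>m (i - 1),
                     mat_of_rows_list 2 [[0, tpow (- 1)], [1, 1 - tpow (- 1)]],
                     1\<^sub>m (m - i - 1)]"

fun burau_letter :: "nat \<Rightarrow> letter \<Rightarrow> laurent mat" where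
  "burau_letter m (Gen k) = burau_gen m k"
| "burau_letter m (Gen_inv k) = burau_gen_inv m k"

fun burau_word :: "nat \<Rightarrow> braid_word \<Rightarrow> laurent mat" where
  "burau_word m [] = 1\<^sub>m m"
| "burau_word m (x # w) = burau_letter m x * burau_word m w"

definition burau :: "nat \<Rightarrow> braid_word set \<Rightarrow> laurent mat" where
  "burau m b = the_elem (burau_word m ` b)"

abbreviation GL_laurent :: "nat \<Rightarrow> laurent mat monoid" where
  "GL_laurent m \<equiv> units_of (ring_mat TYPE(laurent) m ())"


definition block_mat :: "nat \<Rightarrow> nat \<Rightarrow> 'a \<Rightarrow> 'a \<Rightarrow> 'a \<Rightarrow> 'a \<Rightarrow> 'a::zero_neq_one mat" where
  "block_mat m i a b c d = mat m m (\<lambda>(r, s).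
      if r = i - 1 then (if s = i - 1 then a else if s = i then b else 0)
      else if r = i then (if s = i - 1 then c else if s = i then d else 0)
      else if r = s then 1 else 0)"

lemma block_mat_diag:
  assumes "1 \<le> i" "i < m"
  shows "diag_block_mat [1\<^sub>m (i - 1), mat_of_rows_list 2 [[a, b], [c, d]], 1\<^sub>m (m - i - 1)] =
    block_mat m i a b c d"
proof (rule eq_matI)
  fix r s assume "r < dim_row (block_mat m i a b c d)" "s < dim_col (block_mat m i a b c d)"
  then have rs: "r < m" "s < m" by (auto simp: block_mat_def)
  have r: "r < i - 1 \<or> r = i - 1 \<or> r = i \<or> r > i" by linarith
  have s: "s < i - 1 \<or> s = i - 1 \<or> s = i \<or> s > i" by linarith
  obtain k where i: "i = Suc k" using assms by (cases i) auto
  obtain n where m: "m = k + 2 + n" using assms i by (metis add_2_eq_Suc' less_iff_Suc_add add_Suc add.commute)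
  show "diag_block_mat [1\<^sub>m (i - 1), mat_of_rows_list 2 [[a, b], [c, d]], 1\<^sub>m (m - i - 1)]
      $$ (r, s) = block_mat m i a b c d $$ (r, s)"
    using r s rs unfolding i m
    by (elim disjE) (auto simp: Let_def mat_of_rows_list_def block_mat_def)
qed (use assms in \<open>auto simp: Let_def mat_of_rows_list_def block_mat_def\<close>)

lemma block_mat_carrier [simp]: "block_mat m i a b c d \<in> carrier_mat m m"
  by (simp add: block_mat_def)

lemma block_mat_mult:
  fixes M :: "'a::comm_ring_1 mat"
  assumes "1 \<le> i" "i < m" "M \<in> carrier_mat m m"
  shows "block_mat m i a b c d * M = mat m m (\<lambda>(r, s).
      if r = i - 1 then a * M $$ (i - 1, s) + b * M $$ (i, s)
      else if r = i then c * M $$ (i - 1, s) + d * M $$ (i, s)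
      else M $$ (r, s))"
proof (rule eq_matI)
  fix r s assume "r < dim_row (mat m m (\<lambda>(r, s).
      if r = i - 1 then a * M $$ (i - 1, s) + b * M $$ (i, s)
      else if r = i then c * M $$ (i - 1, s) + d * M $$ (i, s)
      else M $$ (r, s)))" "s < dim_col (mat m m (\<lambda>(r, s).
      if r = i - 1 then a * M $$ (i - 1, s) + b * M $$ (i, s)
      else if r = i then c * M $$ (i - 1, s) + d * M $$ (i, s)
      else M $$ (r, s)))"
  then have rs: "r < m" "s < m" by auto
  let ?B = "\<lambda>r k. if r = i - 1 then (if k = i - 1 then a else if k = i then b else 0)
      else if r = i then (if k = i - 1 then c else if k = i then d else 0)
      else if r = k then 1 else 0"
  let ?K = "if r = i - 1 \<or> r = i then {i - 1, i} else {r}"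
  have "(block_mat m i a b c d * M) $$ (r, s) = (\<Sum>k\<in>{0..<m}. ?B r k * M $$ (k, s))"
    using assms rs by (simp add: block_mat_def scalar_prod_def)
  also have "\<dots> = (\<Sum>k\<in>?K. ?B r k * M $$ (k, s))"
    by (rule sum.mono_neutral_right) (use assms rs in \<open>auto split: if_splits\<close>)
  also have "\<dots> = mat m m (\<lambda>(r, s).
      if r = i - 1 then a * M $$ (i - 1, s) + b * M $$ (i, s)
      else if r = i then c * M $$ (i - 1, s) + d * M $$ (i, s)
      else M $$ (r, s)) $$ (r, s)"
    using assms rs by auto
  finally show "(block_mat m i a b c d * M) $$ (r, s) = mat m m (\<lambda>(r, s).
      if r = i - 1 then a * M $$ (i - 1, s) + b * M $$ (i, s)
      else if r = i then c * M $$ (i - 1, s) + d * M $$ (i, s)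
      else M $$ (r, s)) $$ (r, s)" .
qed (use assms in \<open>auto simp: block_mat_def\<close>)

lemma block_mat_commute:
  fixes M :: "'a::comm_ring_1 mat"
  assumes k: "1 \<le> k" "k < m" and l: "1 \<le> l" "l < m" and far: "k + 1 < l \<or> l + 1 < k"
    and M: "M \<in> carrier_mat m m"
  shows "block_mat m k a b c d * (block_mat m l a' b' c' d' * M) =
    block_mat m l a' b' c' d' * (block_mat m k a b c d * M)"
proof -
  have K: "block_mat m k a b c d * M \<in> carrier_mat m m"
    and L: "block_mat m l a' b' c' d' * M \<in> carrier_mat m m"
    using M by (auto intro: mult_carrier_mat[of _ m m])
  have ne: "k \<noteq> l" "k - 1 \<noteq> l" "l - 1 \<noteq> k" "k - 1 \<noteq> l - 1" "k \<noteq> l - 1" "l \<noteq> k - 1"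
    "k - 1 < m" "l - 1 < m" "k - 1 \<noteq> k" "l - 1 \<noteq> l"
    using far k l by linarith+
  show ?thesis
    unfolding block_mat_mult[OF k L] block_mat_mult[OF l K]
    unfolding block_mat_mult[OF k M] block_mat_mult[OF l M]
    by (rule cong_mat) (use k l ne in simp_all)
qed

lemma burau_gen_eq:
  "1 \<le> i \<Longrightarrow> i < m \<Longrightarrow> burau_gen m i = block_mat m i (1 - tpow 1) 1 (tpow 1) 0"
  unfolding burau_gen_def by (rule block_mat_diag)

lemma burau_gen_inv_eq:
  "1 \<le> i \<Longrightarrow> i < m \<Longrightarrow> burau_gen_inv m i = block_mat m i 0 (tpow (- 1)) 1 (1 - tpow (- 1))"
  unfolding burau_gen_inv_def by (rule block_mat_diag)

lemma tpow_inverse: "tpow 1 * tpow (- 1) = 1" "tpow (- 1) * tpow 1 = 1"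
  by (simp_all flip: tpow_add add: tpow_0)

lemma burau_letter_carrier:
  "1 \<le> letter_index x \<Longrightarrow> letter_index x < m \<Longrightarrow> burau_letter m x \<in> carrier_mat m m"
  by (cases x) (auto simp: burau_gen_eq burau_gen_inv_eq)

lemma burau_word_carrier [simp]: "w \<in> braid_words m \<Longrightarrow> burau_word m w \<in> carrier_mat m m"
  by (induction w) (auto intro!: mult_carrier_mat[of _ m m] burau_letter_carrier)

lemma burau_word_append:
  "v \<in> braid_words m \<Longrightarrow> w \<in> braid_words m \<Longrightarrow>
    burau_word m (v @ w) = burau_word m v * burau_word m w"
  by (induction v)
     (auto simp: assoc_mult_mat[of _ m m _ m _ m] burau_letter_carrier left_mult_one_mat[of _ m m])

lemma burau_relator: "braid_relator m x y \<Longrightarrow> burau_word m x = burau_word m y"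
proof (induction rule: braid_relator.induct)
  case (cancel i)
  then show ?case
    using tpow_inverse
    by (auto simp: burau_gen_eq burau_gen_inv_eq block_mat_mult[where m = m] algebra_simps
             intro!: eq_matI)
next
  case (cancel_inv i)
  then show ?case
    using tpow_inverse
    by (auto simp: burau_gen_eq burau_gen_inv_eq block_mat_mult[where m = m] algebra_simps
             intro!: eq_matI)
next
  case (braid i)
  then obtain k where i: "i = Suc k" by (cases i) auto
  show ?case
    using braid unfolding i
    by (simp add: burau_gen_eq block_mat_mult[where m = m]) (rule eq_matI; auto simp: algebra_simps)
next
  case (commute i j)
  then have "i + 1 < j \<or> j + 1 < i" by linarith
  with commute block_mat_commute[of i m j "1\<^sub>m m"] show ?case
    by (simp add: burau_gen_eq)
qed

lemma burau_word_equiv: "braid_equiv m v w \<Longrightarrow> burau_word m v = burau_word m w"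
proof (induction rule: braid_equiv.induct)
  case (rel u v x y)
  then show ?case
    using braid_relator_words[OF rel(3)] by (simp add: burau_word_append burau_relator)
qed auto

lemma burau_class: "w \<in> braid_words m \<Longrightarrow> burau m (braid_class m w) = burau_word m w"
  unfolding burau_def by (rule the_elem_braid_class) (auto intro: burau_word_equiv)

lemma burau_sigma:
  assumes "1 \<le> i" "i < m"
  shows "burau m (braid_class m [Gen i]) = burau_gen m i"
  using assms by (simp add: burau_class burau_gen_eq right_mult_one_mat[of _ m m])

lemma burau_hom: "burau m \<in> hom (braid_group m) (GL_laurent m)"
proof (rule homI)
  fix x assume "x \<in> carrier (braid_group m)"
  then obtain w where w: "w \<in> braid_words m" and x: "x = braid_class m w"
    by (auto simp: carrier_braid_group)
  let ?v = "rev (map letter_inv w)"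
  have v: "?v \<in> braid_words m" and *: "braid_equiv m (?v @ w) []"
    using braid_word_inv[OF w] by auto
  have "map letter_inv (map letter_inv w) = w"
    by (simp add: map_idI letter_inv_inv)
  then have "braid_equiv m (w @ ?v) []"
    using braid_word_inv[OF v] by (simp add: rev_map)
  with * have "burau_word m ?v * burau_word m w = 1\<^sub>m m"
    "burau_word m w * burau_word m ?v = 1\<^sub>m m"
    by (auto dest!: burau_word_equiv simp: burau_word_append v w)
  then show "burau m x \<in> carrier (GL_laurent m)"
    using v w by (auto simp: x burau_class units_of_def Units_def ring_mat_simps
                       intro!: bexI[of _ "burau_word m ?v"])
next
  fix x y assume "x \<in> carrier (braid_group m)" "y \<in> carrier (braid_group m)"
  then show "burau m (x \<otimes>\<^bsub>braid_group m\<^esub> y) = burau m x \<otimes>\<^bsub>GL_laurent m\<^esub> burau m y"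
    by (auto simp: carrier_braid_group mult_braid_group burau_class burau_word_append
                   units_of_def ring_mat_simps)
qed


section \<open>Crossing matrices\<close>

text \<open>
  \<open>crossings s w\<close> lists the crossings of the diagram \<open>w\<close> as triples (sign, over strand, under
  strand), where \<open>s p\<close> is the strand in position \<open>p\<close> at the top of \<open>w\<close>.  At \<open>Gen k\<close> the strand
  moving from position \<open>k + 1\<close> to \<open>k\<close> passes over, at \<open>Gen_inv k\<close> the one moving from \<open>k\<close> to \<open>k + 1\<close>.
\<close>

fun crossings :: "(nat \<Rightarrow> nat) \<Rightarrow> braid_word \<Rightarrow> (int \<times> nat \<times> nat) list" where
  "crossings s [] = []"
| "crossings s (Gen k # w) =
     (1, s (k + 1), s k) # crossings (s \<circ> transpose k (k + 1)) w"
| "crossings s (Gen_inv k # w) =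
     (- 1, s k, s (k + 1)) # crossings (s \<circ> transpose k (k + 1)) w"

definition crossing_number :: "(nat \<Rightarrow> nat) \<Rightarrow> braid_word \<Rightarrow> nat \<Rightarrow> nat \<Rightarrow> int" where
  "crossing_number s w i j =
     int (count_list (crossings s w) (1, i, j)) - int (count_list (crossings s w) (- 1, i, j))"

text \<open>Rows and columns of matrices are counted from \<open>0\<close>, strands from \<open>1\<close>.\<close>

definition crossing_matrix_word :: "nat \<Rightarrow> braid_word \<Rightarrow> int mat" where
  "crossing_matrix_word m w =
     mat m m (\<lambda>(i, j). if i = j then 0 else crossing_number id w (i + 1) (j + 1))"

definition crossing_matrix :: "nat \<Rightarrow> braid_word set \<Rightarrow> int mat" where
  "crossing_matrix m b = the_elem (crossing_matrix_word m ` b)"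

fun strand_at :: "(nat \<Rightarrow> nat) \<Rightarrow> braid_word \<Rightarrow> nat \<Rightarrow> nat" where
  "strand_at s [] = s"
| "strand_at s (x # w) =
     strand_at (s \<circ> transpose (letter_index x) (letter_index x + 1)) w"

lemma crossings_append:
  "crossings s (v @ w) = crossings s v @ crossings (strand_at s v) w"
  by (induction s v rule: crossings.induct) (simp_all del: o_apply add: comp_def)

lemma crossing_number_append:
  "crossing_number s (v @ w) i j = crossing_number s v i j + crossing_number (strand_at s v) w i j"
  by (simp add: crossing_number_def crossings_append)

lemma strand_at_relator: "braid_relator m x y \<Longrightarrow> strand_at s x = strand_at s y"
  by (induction rule: braid_relator.induct) (auto simp: fun_eq_iff transpose_def)

lemma crossing_number_simps:
  "crossing_number s [] i j = 0"
  "crossing_number s (Gen k # w) i j =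
     of_bool (s (k + 1) = i \<and> s k = j) + crossing_number (s \<circ> transpose k (k + 1)) w i j"
  "crossing_number s (Gen_inv k # w) i j =
     crossing_number (s \<circ> transpose k (k + 1)) w i j - of_bool (s k = i \<and> s (k + 1) = j)"
  by (auto simp: crossing_number_def)

lemma crossing_number_relator:
  "braid_relator m x y \<Longrightarrow> crossing_number s x i j = crossing_number s y i j"
proof (induction rule: braid_relator.induct)
  case (commute k l)
  then have "k \<noteq> l" "k \<noteq> Suc l" "l \<noteq> Suc k"
    by auto
  then show ?case
    by (simp add: crossing_number_simps transpose_def)
qed (simp_all add: crossing_number_simps transpose_def)

lemma crossing_number_equiv:
  "braid_equiv m v w \<Longrightarrow> crossing_number s v i j = crossing_number s w i j"
  by (induction rule: braid_equiv.induct)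
     (auto simp: crossing_number_append crossing_number_relator strand_at_relator)

lemma crossing_matrix_class:
  "w \<in> braid_words m \<Longrightarrow> crossing_matrix m (braid_class m w) = crossing_matrix_word m w"
  unfolding crossing_matrix_def
  by (rule the_elem_braid_class) (auto simp: crossing_matrix_word_def crossing_number_equiv)


section \<open>Laplacians\<close>

definition degree_mat :: "int mat \<Rightarrow> int mat" where
  "degree_mat A = mat (dim_row A) (dim_row A)
     (\<lambda>(i, j). if i = j then (\<Sum>k\<in>{0..<dim_row A} - {i}. A $$ (i, k)) else 0)"

definition laplacian :: "int mat \<Rightarrow> int mat" where
  "laplacian A = degree_mat A - A"

end

theory Submission
  imports Defs
begin

text \<open>
  Write \<open>N i j\<close> for the signed number of crossings of a word at which strand \<open>i\<close> is over strand
  \<open>j\<close>, and \<open>\<pi>\<close> for its permutation.  At \<open>t = 1\<close> the Burau matrix is the permutation matrix of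
  \<open>\<pi>\<close>.  Removing the first letter of the word and applying the Leibniz rule, one finds by
  induction that the derivative at \<open>t = 1\<close> has the \<open>(i, r)\<close> entry
  \<open>\<Sum>j. N i j * [\<pi> i = r] - N j i * [\<pi> j = r]\<close>, whether or not the braid is pure.  If \<open>\<pi>\<close> is the
  identity, this is \<open>\<Sum>j. N i j\<close> on the diagonal and \<open>- N r i\<close> off it.  Finally \<open>N\<close> is symmetric
  for pure braids, because \<open>N i j - N j i\<close> is the number of times that \<open>i\<close> passes from the right
  of \<open>j\<close> to its left minus the number of times that it passes back.
\<close>

section \<open>Evaluation and derivative of Laurent polynomials\<close>

text \<open>Keys outside the support contribute zero. Summing over a common finite superset lets
  different polynomials be compared termwise.\<close>

lemma laurent_eval_superset:
  assumes "finite S" "Poly_Mapping.keys p \<subseteq> S"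
  shows "laurent_eval p x = (\<Sum>k\<in>S. of_int (Poly_Mapping.lookup p k) * x powi k)"
  unfolding laurent_eval_def
  by (rule sum.mono_neutral_left) (use assms in \<open>auto simp: in_keys_iff\<close>)

lemma laurent_deriv_superset:
  assumes "finite S" "Poly_Mapping.keys p \<subseteq> S"
  shows "laurent_deriv p = (\<Sum>k\<in>S. Poly_Mapping.single (k - 1) (k * Poly_Mapping.lookup p k))"
  unfolding laurent_deriv_def
  by (rule sum.mono_neutral_left) (use assms in \<open>auto simp: in_keys_iff\<close>)

lemma laurent_eval_add: "laurent_eval (p + q) x = laurent_eval p x + laurent_eval q x"
proof -
  let ?S = "Poly_Mapping.keys p \<union> Poly_Mapping.keys q"
  have "Poly_Mapping.keys (p + q) \<subseteq> ?S"
    by (rule Poly_Mapping.keys_add)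
  then show ?thesis
    by (simp add: laurent_eval_superset[of ?S] lookup_add sum.distrib algebra_simps)
qed

lemma laurent_deriv_add: "laurent_deriv (p + q) = laurent_deriv p + laurent_deriv q"
proof -
  let ?S = "Poly_Mapping.keys p \<union> Poly_Mapping.keys q"
  have "Poly_Mapping.keys (p + q) \<subseteq> ?S"
    by (rule Poly_Mapping.keys_add)
  then show ?thesis
    by (simp add: laurent_deriv_superset[of ?S] lookup_add sum.distrib algebra_simps single_add)
qed

lemma laurent_eval_0 [simp]: "laurent_eval 0 x = 0"
  and laurent_deriv_0 [simp]: "laurent_deriv 0 = 0"
  by (simp_all add: laurent_eval_def laurent_deriv_def)

lemma laurent_eval_diff: "laurent_eval (p - q) x = laurent_eval p x - laurent_eval q x"
  using laurent_eval_add[of "p - q" q x] by simp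

lemma laurent_deriv_diff: "laurent_deriv (p - q) = laurent_deriv p - laurent_deriv q"
  using laurent_deriv_add[of "p - q" q] by simp

lemma laurent_eval_single:
  "laurent_eval (Poly_Mapping.single k c) x = of_int c * x powi k"
  by (subst laurent_eval_superset[of "{k}"]) (auto simp: keys_single)

lemma laurent_deriv_single:
  "laurent_deriv (Poly_Mapping.single k c) = Poly_Mapping.single (k - 1) (k * c)"
  by (subst laurent_deriv_superset[of "{k}"]) (auto simp: keys_single)

lemma laurent_induct [case_names single add]:
  assumes single: "\<And>k c. P (Poly_Mapping.single k c)"
    and add: "\<And>p q. P p \<Longrightarrow> P q \<Longrightarrow> P (p + q)"
  shows "P (p :: laurent)"
proof -
  have *: "P (\<Sum>k\<in>S. Poly_Mapping.single k (Poly_Mapping.lookup p k))" if "finite S" for S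
    using that
  proof (induction S)
    case empty
    \<comment> \<open>The monomial with coefficient \<open>0\<close> is the zero polynomial, which
      is the empty sum.\<close>
    then show ?case using single[of 0 0] by simp
  next
    case (insert k S)
    then show ?case by (simp add: single add)
  qed
  have "(\<Sum>k\<in>Poly_Mapping.keys p. Poly_Mapping.single k (Poly_Mapping.lookup p k)) = p"
    by (rule poly_mapping_eqI)
      (auto simp: lookup_sum lookup_single when_def sum.delta' in_keys_iff)
  with *[of "Poly_Mapping.keys p"] show ?thesis
    by simp
qed

text \<open>Both sides are additive in each factor, so monomials suffice. Exponents add under
  \<open>powi\<close> only away from \<open>0\<close>, since negative exponents mean
  inverses.\<close>

lemma laurent_eval_mult:
  assumes "x \<noteq> 0"
  shows "laurent_eval (p * q) x = laurent_eval p x * laurent_eval q x"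
proof (induction p rule: laurent_induct)
  case (single k c)
  show ?case
    by (induction q rule: laurent_induct)
      (simp_all add: mult_single laurent_eval_single laurent_eval_add power_int_add assms
        algebra_simps)
qed (simp add: laurent_eval_add algebra_simps)

lemma laurent_deriv_mult:
  "laurent_deriv (p * q) = laurent_deriv p * q + p * laurent_deriv q"
proof (induction p rule: laurent_induct)
  case (single k c)
  show ?case
  proof (induction q rule: laurent_induct)
    case (single l d)
    show ?case
      by (simp add: mult_single laurent_deriv_single algebra_simps flip: single_add)
  qed (simp add: laurent_deriv_add algebra_simps)
qed (simp add: laurent_deriv_add algebra_simps)

lemma laurent_eval_1 [simp]: "laurent_eval 1 x = 1"
  and laurent_deriv_1 [simp]: "laurent_deriv 1 = 0"
  using laurent_eval_tpow[of 0 x] laurent_deriv_tpow[of 0] by (simp_all add: tpow_0)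

lemmas laurent_simps = laurent_eval_add laurent_eval_diff laurent_eval_mult laurent_eval_tpow
  laurent_eval_single laurent_deriv_add laurent_deriv_diff laurent_deriv_mult laurent_deriv_tpow


section \<open>Removing the first letter of a word\<close>

text \<open>Renaming strands injectively renames the crossings. After the first letter the strands
  are labelled by a transposition; this restores the labelling \<open>id\<close> that the inductions
  need.\<close>

lemma crossing_number_relabel:
  assumes "inj f"
  shows "crossing_number (f \<circ> s) w (f i) (f j) = crossing_number s w i j"
proof (induction s w rule: crossings.induct)
  case (1 s)
  then show ?case by (simp add: crossing_number_simps)
next
  case (2 s k w)
  then show ?case
    using assms by (simp add: crossing_number_simps inj_eq comp_def)
next
  case (3 s k w)
  then show ?case
    using assms by (simp add: crossing_number_simps inj_eq comp_def)
qed

lemma crossing_number_transpose: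
  "crossing_number (transpose a b) w i j =
    crossing_number id w (transpose a b i) (transpose a b j)"
  using crossing_number_relabel[of "transpose a b" id w "transpose a b i" "transpose a b j"]
  by simp

lemma crossing_number_Gen:
  "crossing_number id (Gen k # w) i j = of_bool (i = k + 1 \<and> j = k) +
    crossing_number id w (transpose k (k + 1) i) (transpose k (k + 1) j)"
  by (auto simp: crossing_number_simps crossing_number_transpose)

lemma crossing_number_Gen_inv:
  "crossing_number id (Gen_inv k # w) i j =
    crossing_number id w (transpose k (k + 1) i) (transpose k (k + 1) j) -
    of_bool (i = k \<and> j = k + 1)"
  by (auto simp: crossing_number_simps crossing_number_transpose)

lemma crossing_number_self: "crossing_number id w i i = 0"
proof (induction w arbitrary: i)
  case Nil
  then show ?case by (simp add: crossing_number_simps)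
next
  case (Cons x w)
  then show ?case
    by (cases x) (simp_all add: crossing_number_Gen crossing_number_Gen_inv del: id_apply)
qed

text \<open>The over strand moves left at a positive crossing and right at a negative one. Each
  crossing of \<open>i\<close> and \<open>j\<close> thus adds to the difference the change in the
  indicator of \<open>i\<close> being left of \<open>j\<close>, and these changes telescope.\<close>

lemma crossing_number_antisym_part:
  assumes "i \<noteq> j"
  shows "crossing_number id w i j - crossing_number id w j i =
    of_bool (lower_position w i < lower_position w j) - of_bool (i < j)"
  using assms
proof (induction w arbitrary: i j)
  case Nil
  then show ?case by (simp add: crossing_number_simps)
next
  case (Cons x w)
  let ?t = "transpose (letter_index x) (letter_index x + 1)"
  have "?t i \<noteq> ?t j"
    using Cons.prems by (metis transpose_involutory)
  note IH = Cons.IH[OF this]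
  show ?case
  proof (cases x)
    case (Gen k)
    \<comment> \<open>The first letter alters the order of \<open>i\<close> and \<open>j\<close>
      only if they are the two adjacent strands that it swaps.\<close>
    have "of_bool (i = k + 1 \<and> j = k) - of_bool (j = k + 1 \<and> i = k) =
        of_bool (?t i < ?t j) - (of_bool (i < j) :: int)"
      using Gen Cons.prems by (auto simp: transpose_def)
    with Gen IH show ?thesis
      by (simp add: crossing_number_Gen del: id_apply)
  next
    case (Gen_inv k)
    have "of_bool (j = k \<and> i = k + 1) - of_bool (i = k \<and> j = k + 1) =
        of_bool (?t i < ?t j) - (of_bool (i < j) :: int)"
      using Gen_inv Cons.prems by (auto simp: transpose_def)
    with Gen_inv IH show ?thesis
      by (simp add: crossing_number_Gen_inv del: id_apply)
  qed
qed

text \<open>Left multiplication by a generator is a row operation. Rows count from \<open>0\<close>,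
  so strands \<open>k\<close> and \<open>k + 1\<close> are rows \<open>k - 1\<close> and
  \<open>k\<close>.\<close>

lemma burau_word_Gen:
  assumes "1 \<le> k" "k < m" "w \<in> braid_words m" "p < m" "q < m"
  shows "burau_word m (Gen k # w) $$ (p, q) =
    (if p = k - 1 then (1 - tpow 1) * burau_word m w $$ (k - 1, q) + burau_word m w $$ (k, q)
     else if p = k then tpow 1 * burau_word m w $$ (k - 1, q)
     else burau_word m w $$ (p, q))"
  using assms by (simp add: burau_gen_eq block_mat_mult)

lemma burau_word_Gen_inv:
  assumes "1 \<le> k" "k < m" "w \<in> braid_words m" "p < m" "q < m"
  shows "burau_word m (Gen_inv k # w) $$ (p, q) =
    (if p = k - 1 then tpow (- 1) * burau_word m w $$ (k, q)
     else if p = k then burau_word m w $$ (k - 1, q) + (1 - tpow (- 1)) * burau_word m w $$ (k, q)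
     else burau_word m w $$ (p, q))"
  using assms by (simp add: burau_gen_inv_eq block_mat_mult)


section \<open>The Burau matrix to first order at 1\<close>

text \<open>At \<open>t = 1\<close> the block of either kind of letter becomes the swap of two
  rows.\<close>

lemma burau_word_eval_1:
  assumes "w \<in> braid_words m" "p < m" "q < m"
  shows "laurent_eval (burau_word m w $$ (p, q)) 1 = of_bool (lower_position w (p + 1) = q + 1)"
  using assms
proof (induction w arbitrary: p)
  case Nil
  then show ?case by simp
next
  case (Cons x w)
  show ?case
  proof (cases x)
    case (Gen k)
    with Cons show ?thesis
      by (auto simp: burau_word_Gen laurent_simps transpose_def simp del: burau_word.simps)
  next
    case (Gen_inv k)
    with Cons show ?thesis
      by (auto simp: burau_word_Gen_inv laurent_simps transpose_def simp del: burau_word.simps)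
  qed
qed

text \<open>The permutation is kept in the formula because the tail of a pure word need not be
  pure.\<close>

definition crossing_laplacian :: "nat \<Rightarrow> braid_word \<Rightarrow> nat \<Rightarrow> nat \<Rightarrow> int" where
  "crossing_laplacian m w i r = (\<Sum>j\<in>{1..m}.
     crossing_number id w i j * of_bool (lower_position w i = r) -
     crossing_number id w j i * of_bool (lower_position w j = r))"

lemma sum_transpose:
  assumes "a \<in> A" "b \<in> A"
  shows "(\<Sum>j\<in>A. g (transpose a b j)) = (\<Sum>j\<in>A. g j)"
  by (rule sum.reindex_bij_witness[of _ "transpose a b" "transpose a b"])
    (use assms in \<open>auto simp: transpose_def\<close>)

text \<open>The last summand is the derivative of the generator at \<open>t = 1\<close>, with block
  rows \<open>(-1, 0)\<close> and \<open>(1, 0)\<close>, times the permutation matrix of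
  \<open>w\<close>.\<close>

lemma crossing_laplacian_Gen:
  assumes "1 \<le> k" "k < m"
  shows "crossing_laplacian m (Gen k # w) i r =
    crossing_laplacian m w (transpose k (k + 1) i) r +
    (of_bool (i = k + 1) - of_bool (i = k)) * of_bool (lower_position w k = r)"
proof -
  let ?t = "transpose k (k + 1)"
  let ?L = "\<lambda>i. of_bool (lower_position w i = r) :: int"
  let ?N = "crossing_number id w"
  have "crossing_laplacian m (Gen k # w) i r =
      (\<Sum>j\<in>{1..m}. ?N (?t i) (?t j) * ?L (?t i) - ?N (?t j) (?t i) * ?L (?t j)) +
      (\<Sum>j\<in>{1..m}. (if j = k then of_bool (i = k + 1) * ?L k else 0) -
        (if j = k + 1 then of_bool (i = k) * ?L k else 0))"
    unfolding crossing_laplacian_def sum.distrib[symmetric]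
    by (rule sum.cong) (auto simp: crossing_number_Gen algebra_simps)
  also have "(\<Sum>j\<in>{1..m}. ?N (?t i) (?t j) * ?L (?t i) - ?N (?t j) (?t i) * ?L (?t j)) =
      crossing_laplacian m w (?t i) r"
    unfolding crossing_laplacian_def using assms
    by (intro sum_transpose[where g = "\<lambda>j. ?N (?t i) j * ?L (?t i) - ?N j (?t i) * ?L j"]) auto
  finally show ?thesis
    using assms by (simp add: sum_subtractf sum.delta algebra_simps)
qed

lemma crossing_laplacian_Gen_inv:
  assumes "1 \<le> k" "k < m"
  shows "crossing_laplacian m (Gen_inv k # w) i r =
    crossing_laplacian m w (transpose k (k + 1) i) r +
    (of_bool (i = k + 1) - of_bool (i = k)) * of_bool (lower_position w (k + 1) = r)"
proof -
  let ?t = "transpose k (k + 1)"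
  let ?L = "\<lambda>i. of_bool (lower_position w i = r) :: int"
  let ?N = "crossing_number id w"
  \<comment> \<open>The second sum collects the single new crossing, strand \<open>k\<close> over
    \<open>k + 1\<close> with sign \<open>-1\<close>; in the tail, strand \<open>k\<close> continues
    from position \<open>k + 1\<close>.\<close>
  have "crossing_laplacian m (Gen_inv k # w) i r =
      (\<Sum>j\<in>{1..m}. ?N (?t i) (?t j) * ?L (?t i) - ?N (?t j) (?t i) * ?L (?t j)) +
      (\<Sum>j\<in>{1..m}. (if j = k then of_bool (i = k + 1) * ?L (k + 1) else 0) -
        (if j = k + 1 then of_bool (i = k) * ?L (k + 1) else 0))"
    unfolding crossing_laplacian_def sum.distrib[symmetric]
    by (rule sum.cong) (auto simp: crossing_number_Gen_inv algebra_simps)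
  also have "(\<Sum>j\<in>{1..m}. ?N (?t i) (?t j) * ?L (?t i) - ?N (?t j) (?t i) * ?L (?t j)) =
      crossing_laplacian m w (?t i) r"
    unfolding crossing_laplacian_def using assms
    by (intro sum_transpose[where g = "\<lambda>j. ?N (?t i) j * ?L (?t i) - ?N j (?t i) * ?L j"]) auto
  finally show ?thesis
    using assms by (simp add: sum_subtractf sum.delta algebra_simps)
qed

text \<open>By the Leibniz rule, the swap acts on the derivative of the tail, and the derivative of
  the letter acts on the permutation matrix of the tail.\<close>

lemma burau_word_deriv_1:
  assumes "w \<in> braid_words m" "p < m" "q < m"
  shows "laurent_eval (laurent_deriv (burau_word m w $$ (p, q))) 1 =
    of_int (crossing_laplacian m w (p + 1) (q + 1))"
  using assms
proof (induction w arbitrary: p)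
  case Nil
  then show ?case by (simp add: crossing_laplacian_def crossing_number_simps)
next
  case (Cons x w)
  show ?case
  proof (cases x)
    case (Gen k)
    with Cons show ?thesis
      by (auto simp: burau_word_Gen laurent_simps burau_word_eval_1 crossing_laplacian_Gen
          transpose_def simp del: burau_word.simps)
  next
    case (Gen_inv k)
    with Cons show ?thesis
      by (auto simp: burau_word_Gen_inv laurent_simps burau_word_eval_1 crossing_laplacian_Gen_inv
          transpose_def simp del: burau_word.simps)
  qed
qed


section \<open>Pure braids\<close>

lemma crossing_laplacian_pure:
  assumes pure: "\<And>p. p \<in> {1..m} \<Longrightarrow> lower_position w p = p" and "p < m" "q < m"
  shows "crossing_laplacian m w (p + 1) (q + 1) = laplacian (crossing_matrix_word m w) $$ (p, q)"
proof -
  let ?N = "crossing_number id w"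
  \<comment> \<open>A pure braid preserves the order of any two strands, so the antisymmetric part
    vanishes.\<close>
  have sym: "?N (q + 1) (p + 1) = ?N (p + 1) (q + 1)"
    using crossing_number_antisym_part[of "p + 1" "q + 1" w] pure[of "p + 1"] pure[of "q + 1"] assms
    by (cases "p = q") auto
  have "crossing_laplacian m w (p + 1) (q + 1) =
      (\<Sum>j\<in>{1..m}. ?N (p + 1) j * of_bool (p = q) - (if j = q + 1 then ?N (q + 1) (p + 1) else 0))"
    unfolding crossing_laplacian_def using pure assms by (intro sum.cong) auto
  also have "\<dots> = (\<Sum>j\<in>{1..m}. ?N (p + 1) j) * of_bool (p = q) - ?N (p + 1) (q + 1)"
    using assms sym by (simp add: sum_subtractf sum_distrib_right)
  also have "(\<Sum>j\<in>{1..m}. ?N (p + 1) j) = (\<Sum>j\<in>{0..<m}. ?N (p + 1) (j + 1))"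
    by (rule sum.reindex_bij_witness[of _ "\<lambda>j. j + 1" "\<lambda>j. j - 1"]) auto
  \<comment> \<open>No strand crosses itself, which matches the omitted diagonal term in the degree
    matrix.\<close>
  also have "\<dots> = (\<Sum>j\<in>{0..<m} - {p}. ?N (p + 1) (j + 1))"
    using assms crossing_number_self[of w "p + 1"] by (simp add: sum.remove[of _ p])
  also have "\<dots> = (\<Sum>j\<in>{0..<m} - {p}. crossing_matrix_word m w $$ (p, j))"
    using assms by (intro sum.cong) (auto simp: crossing_matrix_word_def)
  finally show ?thesis
    using assms crossing_number_self[of w "p + 1"]
    by (auto simp: laplacian_def degree_mat_def crossing_matrix_word_def simp del: id_apply)
qed

theorem theorem1:
  fixes m :: nat and b :: "braid_word set"
  assumes "m \<ge> 1" and "b \<in> pure_braids m"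
  shows "map_mat (\<lambda>p. laurent_eval p 1) (map_mat laurent_deriv (burau m b)) =
    map_mat rat_of_int (laplacian (crossing_matrix m b))"
proof -
  \<comment> \<open>All the invariants of the class are those of any representing word, so the claim
    reduces to words.\<close>
  obtain w where w: "w \<in> braid_words m" and b: "b = braid_class m w"
    using assms by (auto simp: pure_braids_def carrier_braid_group)
  have pure: "lower_position w p = p" if "p \<in> {1..m}" for p
    using assms that w by (auto simp: pure_braids_def b braid_perm_class)
  have dims: "dim_row (burau_word m w) = m" "dim_col (burau_word m w) = m"
    "dim_row (laplacian (crossing_matrix_word m w)) = m"
    "dim_col (laplacian (crossing_matrix_word m w)) = m"
    using burau_word_carrier[OF w] by (auto simp: laplacian_def crossing_matrix_word_def)
  have "crossing_laplacian m w (p + 1) (q + 1) = laplacian (crossing_matrix_word m w) $$ (p, q)"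
    if "p < m" "q < m" for p q
    using pure that by (rule crossing_laplacian_pure)
  then show ?thesis
    unfolding b burau_class[OF w] crossing_matrix_class[OF w]
    by (intro eq_matI) (simp_all add: dims burau_word_deriv_1[OF w] del: One_nat_def Suc_eq_plus1)
qed

end
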